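(* Let $A$ be a finite dimensional central simple algebra with $1$ over a field $F$ (that is, $A$ is a simple algebra, finite dimensional over $F$, with center $\mathcal{Z}(A)=F$). Let $\sigma$ and $\tau$ be non-zero $F$-algebra endomorphisms of $A$. Then there exist units $v_1,v_2$ in $A$ such that for any $F$-linear $(\sigma,\tau)$-derivation $\delta$ of $A$ there is some $u\in A$ with $\delta=v_1\,\delta_u^{inner}\,v_2$, i.e. $\delta(a)=v_1(ua-au)v_2$ for all $a\in A$.
   Context: For $F$-algebra endomorphisms $\sigma,\tau$ of an $F$-algebra $A$ (not necessarily distinct), an $F$-linear $(\sigma,\tau)$-derivation of $A$ is an $F$-linear map $\delta:A\to A$ satisfying $\delta(ab)=\delta(a)\tau(b)+\sigma(a)\delta(b)$ for all $a,b\in A$. For $u\in A$, $\delta_u^{inner}:A\to A$ denotes the usual inner derivation coming from $u$, $\delta_u^{inner}(a)=ua-au$. *)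

theory Defs
  imports Complex_Main
begin

locale assoc_algebra = vector_space scale
  for scale :: "'f::field \<Rightarrow> 'a::ring_1 \<Rightarrow> 'a" +
  assumes scale_mult_left: "scale c a * b = scale c (a * b)"
    and mult_scale_right: "a * scale c b = scale c (a * b)"

definition two_sided_ideal :: "'a::ring_1 set \<Rightarrow> bool" where
  "two_sided_ideal I \<longleftrightarrow>
     0 \<in> I \<and> (\<forall>x\<in>I. \<forall>y\<in>I. x - y \<in> I) \<and> (\<forall>x\<in>I. \<forall>a. a * x \<in> I \<and> x * a \<in> I)"

definition center :: "'a::ring_1 set" where
  "center = {z. \<forall>a. z * a = a * z}"

text \<open>
  The class \<^class>\<open>ring_1\<close> includes \<open>0 \<noteq> 1\<close>, so a simple algebra is nonzero as required.
  The field is identified with its image \<open>c \<mapsto> c \<cdot> 1\<close> in the algebra.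
\<close>
locale central_simple_algebra = assoc_algebra scale
  for scale :: "'f::field \<Rightarrow> 'a::ring_1 \<Rightarrow> 'a" +
  assumes finite_dimensional: "\<exists>B. finite_dimensional_vector_space scale B"
    and simple: "two_sided_ideal (I :: 'a set) \<Longrightarrow> I = {0} \<or> I = UNIV"
    and central: "center = range (\<lambda>c. scale c 1)"

text \<open>Endomorphisms are not required to preserve \<open>1\<close>; in particular the zero map is one.\<close>
definition algebra_endomorphism ::
    "('f::field \<Rightarrow> 'a::ring_1 \<Rightarrow> 'a) \<Rightarrow> ('a \<Rightarrow> 'a) \<Rightarrow> bool" where
  "algebra_endomorphism scale f \<longleftrightarrow>
     Vector_Spaces.linear scale scale f \<and> (\<forall>a b. f (a * b) = f a * f b)"

definition twisted_derivation ::
    "('f::field \<Rightarrow> 'a::ring_1 \<Rightarrow> 'a) \<Rightarrow> ('a \<Rightarrow> 'a) \<Rightarrow> ('a \<Rightarrow> 'a) \<Rightarrow> ('a \<Rightarrow> 'a) \<Rightarrow> bool" where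
  "twisted_derivation scale \<sigma> \<tau> \<delta> \<longleftrightarrow>
     Vector_Spaces.linear scale scale \<delta> \<and>
     (\<forall>a b. \<delta> (a * b) = \<delta> a * \<tau> b + \<sigma> a * \<delta> b)"

definition inner_derivation :: "'a::ring_1 \<Rightarrow> 'a \<Rightarrow> 'a" where
  "inner_derivation u a = u * a - a * u"

text \<open>Two-sided invertibility; \<open>v dvd 1\<close> would only give a right inverse.\<close>
definition ring_unit :: "'a::ring_1 \<Rightarrow> bool" where
  "ring_unit v \<longleftrightarrow> (\<exists>w. v * w = 1 \<and> w * v = 1)"

end

theory Submission
  imports Defs
begin

text \<open>
  By the Artin--Whaples density argument every \<open>F\<close>-linear map on a central simple algebra has the
  form \<open>x \<mapsto> \<Sum>b\<in>B. c b * x * b\<close>, with unique coefficients, for any finite basis \<open>B\<close>.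
  Comparing coefficients in \<open>\<sigma> (a * x) = \<sigma> a * \<sigma> x\<close> yields \<open>c b * a = \<sigma> a * c b\<close>, and a
  nonzero \<open>c b\<close> is a unit; hence \<open>\<sigma>\<close> and \<open>\<tau>\<close> are conjugations by units \<open>s\<close> and \<open>t\<close>.
  If \<open>\<delta>\<close> is a \<open>(\<sigma>, \<tau>)\<close>-derivation, then \<open>d a = s\<^sup>-\<^sup>1 * \<delta> a * t\<close> is an ordinary derivation, and
  comparing coefficients at \<open>1 \<in> B\<close> in \<open>d (a * x) = d a * x + a * d x\<close> shows that \<open>d\<close> is inner.
\<close>

section \<open>Finite sums of two-sided multiplications: the image of \<open>A\<close> tensor its
  opposite ring in the additive endomorphisms of \<open>A\<close>\<close>

inductive mult_map :: "('a::ring_1 \<Rightarrow> 'a) \<Rightarrow> bool" where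
  sandwich: "mult_map (\<lambda>x. p * x * q)"
| add: "mult_map f \<Longrightarrow> mult_map g \<Longrightarrow> mult_map (\<lambda>x. f x + g x)"

lemma mult_map_zero: "mult_map (\<lambda>x. 0)"
  using mult_map.sandwich[of 0 0] by simp

lemma mult_map_id: "mult_map (\<lambda>x. x)"
  using mult_map.sandwich[of 1 1] by simp

lemma mult_map_mult_left: "mult_map f \<Longrightarrow> mult_map (\<lambda>x. a * f x)"
proof (induction rule: mult_map.induct)
  case (sandwich p q)
  show ?case using mult_map.sandwich[of "a * p" q] by (simp add: mult.assoc)
qed (simp add: distrib_left mult_map.add)

lemma mult_map_mult_right: "mult_map f \<Longrightarrow> mult_map (\<lambda>x. f x * a)"
proof (induction rule: mult_map.induct)
  case (sandwich p q)
  show ?case using mult_map.sandwich[of p "q * a"] by (simp add: mult.assoc)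
qed (simp add: distrib_right mult_map.add)

lemma mult_map_diff: "mult_map f \<Longrightarrow> mult_map g \<Longrightarrow> mult_map (\<lambda>x. f x - g x)"
  using mult_map.add[OF _ mult_map_mult_left[of g "-1"]] by fastforce

lemma mult_map_sum:
  "(\<And>i. i \<in> I \<Longrightarrow> mult_map (f i)) \<Longrightarrow> mult_map (\<lambda>x. \<Sum>i\<in>I. f i x)"
  by (induction I rule: infinite_finite_induct)
    (simp_all add: mult_map_zero mult_map.add)

text \<open>For a sandwich map the sum is the relation at \<open>x = p\<close>, multiplied by
  \<open>q\<close> on the right, and the claim is additive in \<open>f\<close>. The right-hand
  factors \<open>b\<close> of a relation may thus be replaced by \<open>f b\<close>.\<close>

lemma mult_map_annihilates:
  assumes "mult_map f" and "\<And>x. (\<Sum>b\<in>B. c b * x * b) = 0"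
  shows "(\<Sum>b\<in>B. c b * f b) = 0"
  using assms(1)
proof (induction rule: mult_map.induct)
  case (sandwich p q)
  have "(\<Sum>b\<in>B. c b * (p * b * q)) = (\<Sum>b\<in>B. c b * p * b) * q"
    by (simp add: sum_distrib_right mult.assoc)
  then show ?case by (simp add: assms(2))
qed (simp add: distrib_left sum.distrib)

section \<open>Density of the multiplication maps\<close>

context central_simple_algebra
begin

lemma linear_iff_add_scale:
  "Vector_Spaces.linear scale scale f \<longleftrightarrow>
    (\<forall>x y. f (x + y) = f x + f y) \<and> (\<forall>c x. f (scale c x) = scale c (f x))"
  by (simp add: Vector_Spaces.linear_iff vector_space_axioms)

lemma linear_mult_map: "mult_map f \<Longrightarrow> Vector_Spaces.linear scale scale f"
  by (induction rule: mult_map.induct)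
    (simp_all add: linear_iff_add_scale algebra_simps mult_scale_right scale_mult_left)

lemma one_in_ideal: "two_sided_ideal (I :: 'a set) \<Longrightarrow> x \<in> I \<Longrightarrow> x \<noteq> 0 \<Longrightarrow> 1 \<in> I"
  using simple by fastforce

text \<open>The values at \<open>b\<close> of all multiplication maps vanishing on \<open>S\<close>
  form a two-sided ideal. It contains \<open>f b \<noteq> 0\<close>, so by simplicity it contains
  \<open>1\<close>.\<close>

lemma mult_map_to_one:
  fixes f :: "'a \<Rightarrow> 'a"
  assumes "mult_map f" "\<forall>s\<in>S. f s = 0" "f b \<noteq> 0"
  shows "\<exists>g. mult_map g \<and> (\<forall>s\<in>S. g s = 0) \<and> g b = 1"
proof -
  define I where "I = {f b | f. mult_map f \<and> (\<forall>s\<in>S. f s = 0)}"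
  have "two_sided_ideal I"
    unfolding two_sided_ideal_def
  proof (intro conjI ballI allI)
    show "0 \<in> I" unfolding I_def using mult_map_zero by fastforce
  next
    fix x y assume "x \<in> I" "y \<in> I"
    then obtain f g where "mult_map f" "\<forall>s\<in>S. f s = 0" "mult_map g" "\<forall>s\<in>S. g s = 0"
      "x = f b" "y = g b" unfolding I_def by blast
    then show "x - y \<in> I" unfolding I_def
      by (intro CollectI exI[of _ "\<lambda>x. f x - g x"]) (simp add: mult_map_diff)
  next
    fix x a assume "x \<in> I"
    then obtain f where f: "mult_map f" "\<forall>s\<in>S. f s = 0" "x = f b" unfolding I_def by blast
    show "a * x \<in> I" using f unfolding I_def
      by (intro CollectI exI[of _ "\<lambda>x. a * f x"]) (simp add: mult_map_mult_left)
    show "x * a \<in> I" using f unfolding I_def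
      by (intro CollectI exI[of _ "\<lambda>x. f x * a"]) (simp add: mult_map_mult_right)
  qed
  moreover have "f b \<in> I" using assms unfolding I_def by blast
  ultimately have "1 \<in> I" using one_in_ideal assms(3) by blast
  then show ?thesis unfolding I_def by force
qed

text \<open>Induction on \<open>S\<close>: a map \<open>f\<close> that kills \<open>S\<close> with
  \<open>f s = 1\<close> is modified so as to kill \<open>s\<close> too, in a way that depends on
  whether \<open>f b\<close> is central.\<close>

lemma density:
  assumes "finite S" "independent S" "b \<notin> span S"
  shows "\<exists>f. mult_map f \<and> (\<forall>s\<in>S. f s = 0) \<and> f b = 1"
  using assms
proof (induction S arbitrary: b rule: finite_induct)
  case empty
  then show ?case using mult_map_to_one[OF mult_map_id, of "{}" b] by simp
next
  case (insert s S)
  have S: "independent S" and s: "s \<notin> span S"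
    using insert.prems(1) insert.hyps by (auto simp: independent_insert)
  obtain f where f: "mult_map f" "\<forall>s\<in>S. f s = 0" "f s = 1"
    using insert.IH[OF S s] by blast
  show ?case
  proof (cases "f b \<in> center")
    case False
    then obtain a where "f b * a \<noteq> a * f b" by (auto simp: center_def)
    \<comment> \<open>The commutator with \<open>a\<close> vanishes at \<open>s\<close> because
      \<open>f s = 1\<close> is central, but not at \<open>b\<close>.\<close>
    moreover have "mult_map (\<lambda>x. f x * a - a * f x)"
      using f by (intro mult_map_diff mult_map_mult_left mult_map_mult_right)
    ultimately show ?thesis
      using mult_map_to_one[of "\<lambda>x. f x * a - a * f x" "insert s S" b] f by auto
  next
    case True
    then obtain c where c: "f b = scale c 1" using central by auto
    \<comment> \<open>Otherwise \<open>b\<close> would lie in the span of \<open>insert s S\<close>.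
      The induction hypothesis is applied to this shifted vector.\<close>
    have "b - scale c s \<notin> span S"
      using insert.prems(2) by (auto simp: span_insert)
    then obtain h where h: "mult_map h" "\<forall>s\<in>S. h s = 0" "h (b - scale c s) = 1"
      using insert.IH[OF S] by blast
    have hlin: "Vector_Spaces.linear scale scale h" by (rule linear_mult_map) fact
    have "h b - h (scale c s) = 1"
      using h(3) module_hom.diff[OF hlin[unfolded linear_iff_module_hom]] by simp
    moreover have "h (scale c s) = scale c (h s)" using hlin by (simp add: linear_iff_add_scale)
    ultimately have "h b - h s * f b = 1" by (simp add: c mult_scale_right)
    \<comment> \<open>Subtracting \<open>h s * f x\<close> kills \<open>s\<close>, since
      \<open>f s = 1\<close>, and leaves \<open>h (b - scale c s) = 1\<close> at
      \<open>b\<close>.\<close>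
    moreover have "mult_map (\<lambda>x. h x - h s * f x)"
      using f h by (intro mult_map_diff mult_map_mult_left)
    ultimately show ?thesis using f h by (intro exI[of _ "\<lambda>x. h x - h s * f x"]) auto
  qed
qed

lemma dual_mult_map:
  assumes "finite B" "independent B" "b \<in> B"
  shows "\<exists>f. mult_map f \<and> (\<forall>b'\<in>B. f b' = (if b' = b then 1 else 0))"
proof -
  have "b \<notin> span (B - {b})" using assms by (auto simp: dependent_def)
  moreover have "independent (B - {b})" using assms independent_mono by blast
  ultimately obtain f where "mult_map f" "\<forall>s\<in>B - {b}. f s = 0" "f b = 1"
    using density[of "B - {b}" b] assms by blast
  then show ?thesis by (intro exI[of _ f]) auto
qed

section \<open>Existence and uniqueness of coefficients with respect to a basis\<close>

lemma coefficients_zero: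
  assumes "finite B" "independent B" "b \<in> B" and "\<And>x. (\<Sum>b\<in>B. c b * x * b) = 0"
  shows "c b = 0"
proof -
  obtain f where f: "mult_map f" "\<forall>b'\<in>B. f b' = (if b' = b then 1 else 0)"
    using dual_mult_map assms by blast
  have "0 = (\<Sum>b'\<in>B. c b' * f b')" using mult_map_annihilates[OF f(1) assms(4)] by simp
  also have "\<dots> = (\<Sum>b'\<in>B. if b' = b then c b' else 0)" using f by (intro sum.cong) auto
  also have "\<dots> = c b" using assms by simp
  finally show ?thesis by simp
qed

lemma coefficients_eq:
  assumes "finite B" "independent B" "b \<in> B"
    and "\<And>x. (\<Sum>b\<in>B. c b * x * b) = (\<Sum>b\<in>B. c' b * x * b)"
  shows "c b = c' b"
  using coefficients_zero[of B b "\<lambda>b. c b - c' b"] assms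
  by (simp add: left_diff_distrib sum_subtractf)

text \<open>Expanding \<open>q\<close> in \<open>B\<close> and moving the scalars into the left
  factor brings every sandwich map to this form.\<close>

lemma mult_map_coefficients:
  assumes "finite B" "span B = UNIV" "mult_map f"
  shows "\<exists>c. \<forall>x. f x = (\<Sum>b\<in>B. c b * x * b)"
  using assms(3)
proof (induction rule: mult_map.induct)
  case (sandwich p q)
  have "q \<in> span B" using assms by simp
  then obtain r where "q = (\<Sum>b\<in>B. scale (r b) b)" using span_finite[OF assms(1)] by auto
  then show ?case
    by (intro exI[of _ "\<lambda>b. scale (r b) p"])
      (simp add: sum_distrib_left scale_mult_left mult_scale_right)
next
  case (add f g)
  then obtain c d where "\<forall>x. f x = (\<Sum>b\<in>B. c b * x * b)" "\<forall>x. g x = (\<Sum>b\<in>B. d b * x * b)"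
    by blast
  then show ?case
    by (intro exI[of _ "\<lambda>b. c b + d b"]) (simp add: distrib_right sum.distrib)
qed

text \<open>With dual maps \<open>f b\<close>, the sum of \<open>L b * f b x\<close> is a
  multiplication map that agrees with \<open>L\<close> on the basis, hence everywhere.\<close>

lemma linear_coefficients:
  assumes B: "finite B" "independent B" "span B = UNIV"
    and L: "Vector_Spaces.linear scale scale L"
  shows "\<exists>c. \<forall>x. L x = (\<Sum>b\<in>B. c b * x * b)"
proof -
  obtain f where f: "\<And>b. b \<in> B \<Longrightarrow> mult_map (f b)"
    "\<And>b b'. b \<in> B \<Longrightarrow> b' \<in> B \<Longrightarrow> f b b' = (if b' = b then 1 else 0)"
    using dual_mult_map[OF B(1,2)] by metis
  define g where "g = (\<lambda>x. \<Sum>b\<in>B. L b * f b x)"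
  have g: "mult_map g" unfolding g_def using f by (intro mult_map_sum mult_map_mult_left)
  have "g b' = L b'" if "b' \<in> B" for b'
  proof -
    have "g b' = (\<Sum>b\<in>B. if b' = b then L b else 0)"
      unfolding g_def using f that by (intro sum.cong) auto
    then show ?thesis using B that by simp
  qed
  moreover interpret vector_space_pair scale scale ..
  have "g x = L x" if "\<And>b. b \<in> B \<Longrightarrow> g b = L b" for x
    by (rule linear_eq_on[OF linear_mult_map[OF g] L, of _ B]) (use B that in auto)
  ultimately have "g x = L x" for x by blast
  then show ?thesis using mult_map_coefficients[OF B(1,3) g] by simp
qed

text \<open>With \<open>1\<close> in the basis, a left multiplication \<open>p * x\<close> is the
  single basis term \<open>p * x * 1\<close>; \<open>derivation_inner\<close> relies on
  this.\<close>

lemma finite_basis_with_one: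
  obtains B where "finite B" "independent B" "span B = UNIV" "1 \<in> B"
proof -
  obtain E where "finite_dimensional_vector_space scale E" using finite_dimensional ..
  then interpret fd: finite_dimensional_vector_space scale E .
  have i: "independent {1}" by simp
  show ?thesis
    using that[of "extend_basis {1}"] fd.finiteI_independent independent_extend_basis[OF i]
      span_extend_basis[OF i] extend_basis_superset[OF i] by blast
qed

text \<open>Left multiplication by \<open>u\<close> is injective because of \<open>w\<close>, hence
  surjective in finite dimension. A preimage of \<open>1\<close> is a right inverse and must equal
  \<open>w\<close>.\<close>

lemma right_inverse_of_left_inverse:
  fixes u w :: 'a
  assumes "w * u = 1"
  shows "u * w = 1"
proof -
  obtain E where "finite_dimensional_vector_space scale E" using finite_dimensional ..
  then interpret fd: finite_dimensional_vector_space scale E .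
  have "Vector_Spaces.linear scale scale (\<lambda>x. u * x)"
    by (simp add: linear_iff_add_scale distrib_left mult_scale_right)
  moreover have "inj (\<lambda>x. u * x)"
    by (rule inj_on_inverseI[of _ "\<lambda>x. w * x"]) (simp add: assms flip: mult.assoc)
  ultimately have "surj (\<lambda>x. u * x)" by (rule fd.linear_inj_imp_surj)
  then obtain z where z: "u * z = 1" by (metis surjD)
  then have "w = z" using assms by (metis mult.assoc mult_1_left mult_1_right)
  then show ?thesis using z by simp
qed

theorem skolem_noether:
  assumes "algebra_endomorphism scale \<sigma>" and "\<sigma> \<noteq> (\<lambda>_. 0)"
  shows "\<exists>s s'. s * s' = 1 \<and> s' * s = 1 \<and> (\<forall>a. \<sigma> a = s * a * s')"
proof -
  obtain B where B: "finite B" "independent B" "span B = UNIV" "1 \<in> B"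
    by (rule finite_basis_with_one)
  have hom: "\<sigma> (a * b) = \<sigma> a * \<sigma> b" for a b
    using assms(1) by (simp add: algebra_endomorphism_def)
  obtain c where c: "\<And>x. \<sigma> x = (\<Sum>b\<in>B. c b * x * b)"
    using linear_coefficients[OF B(1-3), of \<sigma>] assms(1)
    unfolding algebra_endomorphism_def by blast
  have comm: "c b * a = \<sigma> a * c b" if "b \<in> B" for a b
  proof (rule coefficients_eq[OF B(1,2) that])
    fix x
    have "(\<Sum>b\<in>B. c b * a * x * b) = \<sigma> (a * x)" unfolding c by (simp add: mult.assoc)
    also have "\<dots> = (\<Sum>b\<in>B. \<sigma> a * c b * x * b)"
      by (simp add: hom c[of x] sum_distrib_left mult.assoc)
    finally show "(\<Sum>b\<in>B. c b * a * x * b) = (\<Sum>b\<in>B. \<sigma> a * c b * x * b)" .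
  qed
  obtain b where b: "b \<in> B" "c b \<noteq> 0"
  proof (rule ccontr)
    assume "\<not> thesis"
    then have "\<forall>b\<in>B. c b = 0" using that by blast
    then have "\<sigma> = (\<lambda>_. 0)" by (intro ext) (simp add: c)
    then show False using assms(2) by blast
  qed
  define s where "s = c b"
  have s: "s * a = \<sigma> a * s" for a unfolding s_def by (rule comm[OF b(1)])
  \<comment> \<open>The left ideal generated by \<open>s\<close> is also a right ideal, since
    \<open>s * a = \<sigma> a * s\<close>. Simplicity then yields a left inverse of
    \<open>s\<close>.\<close>
  define I where "I = range (\<lambda>x. x * s)"
  have "two_sided_ideal I"
    unfolding two_sided_ideal_def
  proof (intro conjI ballI allI)
    show "0 \<in> I" unfolding I_def by (rule range_eqI[of _ _ 0]) simp
  next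
    fix x y assume "x \<in> I" "y \<in> I"
    then show "x - y \<in> I" unfolding I_def by (auto simp flip: left_diff_distrib)
  next
    fix x a assume "x \<in> I"
    then obtain y where y: "x = y * s" unfolding I_def by blast
    show "a * x \<in> I" unfolding I_def y by (rule range_eqI[of _ _ "a * y"]) (simp add: mult.assoc)
    show "x * a \<in> I" unfolding I_def y
      by (rule range_eqI[of _ _ "y * \<sigma> a"]) (simp add: mult.assoc s)
  qed
  moreover have "s \<in> I" unfolding I_def by (rule range_eqI[of _ _ 1]) simp
  ultimately have "1 \<in> I" using one_in_ideal b(2) by (auto simp: s_def)
  then obtain s' where s': "s' * s = 1" unfolding I_def by force
  then have inv: "s * s' = 1" by (rule right_inverse_of_left_inverse)
  moreover have "\<sigma> a = s * a * s'" for a by (metis s inv mult.assoc mult_1_right)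
  ultimately show ?thesis using s' by blast
qed

lemma derivation_inner:
  assumes d: "Vector_Spaces.linear scale scale d" "\<And>a b. d (a * b) = d a * b + a * d b"
  shows "\<exists>u. \<forall>a. d a = inner_derivation u a"
proof -
  obtain B where B: "finite B" "independent B" "span B = UNIV" "1 \<in> B"
    by (rule finite_basis_with_one)
  obtain c where c: "\<And>x. d x = (\<Sum>b\<in>B. c b * x * b)"
    using linear_coefficients[OF B(1-3) d(1)] by blast
  \<comment> \<open>The \<open>if\<close> is the coefficient of \<open>d a * x\<close> in the whole
    family over \<open>B\<close>, taken at \<open>b = 1\<close>. The equation makes
    \<open>c 1\<close> the element inducing \<open>d\<close>.\<close>
  have "c 1 * a = (if (1::'a) = 1 then d a else 0) + a * c 1" for a
  proof (rule coefficients_eq[OF B(1,2,4),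
        of "\<lambda>b. c b * a" "\<lambda>b. (if b = 1 then d a else 0) + a * c b"])
    fix x
    have eq: "(\<Sum>b\<in>B. (if b = 1 then d a else 0) * x * b) = (\<Sum>b\<in>B. if b = 1 then d a * x else 0)"
      by (intro sum.cong) auto
    have "(\<Sum>b\<in>B. c b * a * x * b) = d (a * x)" unfolding c by (simp add: mult.assoc)
    also have "\<dots> = d a * x + (\<Sum>b\<in>B. a * c b * x * b)"
      by (simp add: d(2) c[of x] sum_distrib_left mult.assoc)
    also have "\<dots> = (\<Sum>b\<in>B. ((if b = 1 then d a else 0) + a * c b) * x * b)"
      unfolding distrib_right sum.distrib eq using B by simp
    finally show "(\<Sum>b\<in>B. c b * a * x * b) =
      (\<Sum>b\<in>B. ((if b = 1 then d a else 0) + a * c b) * x * b)" .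
  qed
  then have "d a = inner_derivation (c 1) a" for a by (simp add: inner_derivation_def)
  then show ?thesis by blast
qed

end

text \<open>The units come from \<open>\<sigma>\<close> and \<open>\<tau>\<close> alone, so one pair
  serves every \<open>\<delta>\<close>.\<close>

theorem proposition2p8:
  fixes scale :: "'f::field \<Rightarrow> 'a::ring_1 \<Rightarrow> 'a"
    and \<sigma> \<tau> :: "'a \<Rightarrow> 'a"
  assumes "central_simple_algebra scale"
    and "algebra_endomorphism scale \<sigma>" and "\<sigma> \<noteq> (\<lambda>_. 0)"
    and "algebra_endomorphism scale \<tau>" and "\<tau> \<noteq> (\<lambda>_. 0)"
  shows "\<exists>v\<^sub>1 v\<^sub>2. ring_unit v\<^sub>1 \<and> ring_unit v\<^sub>2 \<and>
    (\<forall>\<delta>. twisted_derivation scale \<sigma> \<tau> \<delta> \<longrightarrow>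
      (\<exists>u. \<forall>a. \<delta> a = v\<^sub>1 * inner_derivation u a * v\<^sub>2))"
proof -
  interpret central_simple_algebra scale by fact
  obtain s s' where s: "s * s' = 1" "s' * s = 1" "\<And>a. \<sigma> a = s * a * s'"
    using skolem_noether[OF assms(2,3)] by blast
  obtain t t' where t: "t * t' = 1" "t' * t = 1" "\<And>a. \<tau> a = t * a * t'"
    using skolem_noether[OF assms(4,5)] by blast
  have cancel: "s * (s' * x) = x" "s' * (s * x) = x" "t * (t' * x) = x" "t' * (t * x) = x" for x
    using s t by (simp_all flip: mult.assoc)
  show ?thesis
  proof (rule exI[of _ s], rule exI[of _ t'], intro conjI allI impI)
    show "ring_unit s" "ring_unit t'" using s t by (auto simp: ring_unit_def)
    fix \<delta> assume \<delta>: "twisted_derivation scale \<sigma> \<tau> \<delta>"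
    define d where "d = (\<lambda>a. s' * \<delta> a * t)"
    have "Vector_Spaces.linear scale scale d"
      using \<delta> by (simp add: d_def twisted_derivation_def linear_iff_add_scale algebra_simps
          mult_scale_right scale_mult_left)
    \<comment> \<open>The identities \<open>\<tau> b * t = t * b\<close> and
      \<open>s' * \<sigma> a = a * s'\<close> turn the twisted rule into the ordinary Leibniz
      rule.\<close>
    moreover have "d (a * b) = d a * b + a * d b" for a b
      using \<delta> by (simp add: d_def twisted_derivation_def s t(3) algebra_simps cancel t(2))
    ultimately obtain u where "\<And>a. d a = inner_derivation u a" using derivation_inner by blast
    moreover have "\<delta> a = s * d a * t'" for a by (simp add: d_def mult.assoc cancel t)
    ultimately show "\<exists>u. \<forall>a. \<delta> a = s * inner_derivation u a * t'" by auto
  qed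
qed

end
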